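(* Let $X$ be a locally finite poset and $K$ a field. Let $\beta\in I(X,K)$ be invertible, $\sigma\in I(X,K)$ multiplicative, $\lambda\in\mathrm{Aut}(X)$, and let $\varphi=\xi_\beta\circ M_\sigma\circ\hat\lambda$. Then the $K$-space $\mathrm{Der}^{\varphi}(I(X,K))/\mathrm{IDer}^{\varphi}(I(X,K))$ is isomorphic to $H^1_{(\sigma,\lambda)}(X,K)$.
   Context: A poset is locally finite if all its intervals $\{z: x\le z\le y\}$ are finite. $\mathrm{Aut}(X)$ is the group of bijections $\lambda:X\to X$ with $x\le y\iff\lambda(x)\le\lambda(y)$. The incidence algebra $I(X,K)$ is the $K$-space of functions $f:X\times X\to K$ with $f(x,y)=0$ for $x\nleq y$, with product $(fg)(x,y)=\sum_{x\le z\le y}f(x,z)g(z,y)$; it is associative and unital. For invertible $\beta\in I(X,K)$, $\xi_\beta$ is the inner automorphism $\xi_\beta(f)=\beta f\beta^{-1}$. An element $\sigma\in I(X,K)$ is multiplicative if $\sigma(x,y)\ne 0$ for all $x\le y$ and $\sigma(x,z)=\sigma(x,y)\sigma(y,z)$ whenever $x\le y\le z$; it determines the automorphism $M_\sigma$ of $I(X,K)$, $M_\sigma(f)(x,y)=\sigma(x,y)f(x,y)$. Each $\lambda\in\mathrm{Aut}(X)$ induces the automorphism $\hat\lambda$ of $I(X,K)$, $\hat\lambda(f)(x,y)=f(\lambda^{-1}(x),\lambda^{-1}(y))$. For a $K$-algebra $A$ and $\varphi\in\mathrm{Aut}(A)$, a $\varphi$-derivation of $A$ is a linear map $d:A\to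 A$ with $d(ab)=d(a)b+\varphi(a)d(b)$ for all $a,b\in A$; $\mathrm{Der}^{\varphi}(A)$ is the $K$-space of all of them. If $A$ is associative, then for $a\in A$ the map $D^\varphi_a(b)=ab-\varphi(b)a$ is an inner $\varphi$-derivation; $\mathrm{IDer}^{\varphi}(A)$ is the subspace of all inner $\varphi$-derivations. Cohomology: for $n>0$ let $X^n_\le=\{(x_0,\dots,x_{n-1})\in X^n: x_0\le\dots\le x_{n-1}\}$. For $n\ge0$ let $C^n(X,K)$ be the $K$-space of all functions $f:X^{n+1}_\le\to K$ and $C^n_\lambda(X,K)=\{f\in C^n(X,K): f(x_0,\dots,x_n)=0\text{ if }\lambda(x_0)\nleq x_n\}$. Define $\delta^n_{(\sigma,\lambda)}:C^n(X,K)\to C^{n+1}(X,K)$ by $$(\delta^n_{(\sigma,\lambda)}f)(x_0,\dots,x_{n+1})=\sigma(\lambda(x_0),\lambda(x_1))f(x_1,\dots,x_{n+1})+\sum_{i=1}^{n+1}(-1)^if(x_0,\dots,\widehat{x_i},\dots,x_{n+1}),$$ where $\widehat{x_i}$ means that $x_i$ is removed. These maps restrict to a cochain complex $C^0_\lambda(X,K)\to C^1_\lambda(X,K)\to\cdots$. For this complex, $Z^n_{(\sigma,\lambda)}(X,K)=\ker\delta^n_{(\sigma,\lambda)}\subseteq C^n_\lambda(X,K)$ for $n\ge0$, $B^n_{(\sigma,\lambda)}(X,K)=\delta^{n-1}_{(\sigma,\lambda)}(C^{n-1}_\lambda(X,K))$ for $n>0$, $H^n_{(\sigma,\lambda)}(X,K)=Z^n_{(\sigma,\lambda)}(X,K)/B^n_{(\sigma,\lambda)}(X,K)$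 for $n>0$, and $H^0_{(\sigma,\lambda)}(X,K)=Z^0_{(\sigma,\lambda)}(X,K)$. *)

theory Defs
  imports Complex_Main "HOL-Library.Function_Algebras" "HOL-Library.Set_Algebras"
begin

text \<open>
  Addition of functions is pointwise (\<^theory>\<open>HOL-Library.Function_Algebras\<close>), and \<open>A + B\<close> and
  \<open>v +o W\<close> on sets are the Minkowski sum and the translate
  (\<^theory>\<open>HOL-Library.Set_Algebras\<close>).
\<close>

record ('k, 'v) kspace =
  kcarrier :: "'v set"
  kadd :: "'v \<Rightarrow> 'v \<Rightarrow> 'v"
  kscale :: "'k \<Rightarrow> 'v \<Rightarrow> 'v"

text \<open>
  The space \<open>V / W\<close> for subspaces \<open>W \<subseteq> V\<close> of a type with scalar multiplication \<open>s\<close>. The summand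
  \<open>W\<close> in the scalar multiplication only matters for the scalar \<open>0\<close>: the image of a coset under
  multiplication by \<open>0\<close> is \<open>{0}\<close>, not the coset \<open>W\<close>.
\<close>

definition quotient_space ::
  "('k \<Rightarrow> 'v \<Rightarrow> 'v::ab_group_add) \<Rightarrow> 'v set \<Rightarrow> 'v set \<Rightarrow> ('k, 'v set) kspace" where
  "quotient_space s V W =
     \<lparr>kcarrier = (\<lambda>v. v +o W) ` V, kadd = (+), kscale = (\<lambda>c A. s c ` A + W)\<rparr>"

definition isomorphic_spaces :: "('k, 'v) kspace \<Rightarrow> ('k, 'w) kspace \<Rightarrow> bool" where
  "isomorphic_spaces S T \<longleftrightarrow>
     (\<exists>F. bij_betw F (kcarrier S) (kcarrier T) \<and>
          (\<forall>u\<in>kcarrier S. \<forall>v\<in>kcarrier S. F (kadd S u v) = kadd T (F u) (F v)) \<and>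
          (\<forall>c. \<forall>v\<in>kcarrier S. F (kscale S c v) = kscale T c (F v)))"

definition fun_scale :: "('k \<Rightarrow> 'v \<Rightarrow> 'v) \<Rightarrow> 'k \<Rightarrow> ('a \<Rightarrow> 'v) \<Rightarrow> 'a \<Rightarrow> 'v" where
  "fun_scale s c f = (\<lambda>a. s c (f a))"

lemma vector_space_fun_scale: "vector_space s \<Longrightarrow> vector_space (fun_scale s)"
  by (simp add: vector_space_def fun_scale_def plus_fun_def fun_eq_iff)

lemma quotient_space_simps:
  assumes "vector_space s" and W: "module.subspace s W"
  shows "kadd (quotient_space s V W) (u +o W) (v +o W) = (u + v) +o W"
    and "kscale (quotient_space s V W) c (v +o W) = s c v +o W"
proof -
  interpret vector_space s by fact
  have W0: "0 \<in> W" and Wa: "\<And>x y. x \<in> W \<Longrightarrow> y \<in> W \<Longrightarrow> x + y \<in> W"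
    and Ws: "\<And>c x. x \<in> W \<Longrightarrow> s c x \<in> W"
    using W by (auto simp: subspace_def)
  have W_absorb: "U + W = W" if "U \<subseteq> W" "0 \<in> U" for U
  proof
    show "U + W \<subseteq> W" using that Wa by (auto simp: set_plus_def)
    show "W \<subseteq> U + W" using that set_plus_intro[of 0 U] by (metis add_0 subsetI)
  qed
  show "kadd (quotient_space s V W) (u +o W) (v +o W) = (u + v) +o W"
    by (simp add: quotient_space_def set_plus_rearrange W_absorb W0)
  have "s c ` (v +o W) = s c v +o s c ` W"
    by (force simp: elt_set_plus_def scale_right_distrib image_iff)
  moreover have "s c ` W + W = W"
    using W0 Ws by (intro W_absorb) (auto simp: image_iff intro!: bexI[of _ 0])
  ultimately show "kscale (quotient_space s V W) c (v +o W) = s c v +o W"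
    by (simp add: quotient_space_def set_plus_rearrange3)
qed

definition twisted_derivations ::
  "('k::field \<Rightarrow> 'a \<Rightarrow> 'a) \<Rightarrow> ('a \<Rightarrow> 'a) \<Rightarrow> ('a::ring_1 \<Rightarrow> 'a) set" where
  "twisted_derivations s \<phi> =
     {d. Vector_Spaces.linear s s d \<and> (\<forall>a b. d (a * b) = d a * b + \<phi> a * d b)}"

definition inner_twisted_derivations :: "('a \<Rightarrow> 'a) \<Rightarrow> ('a::ring_1 \<Rightarrow> 'a) set" where
  "inner_twisted_derivations \<phi> = range (\<lambda>a b. a * b - \<phi> b * a)"

definition ring_invertible :: "'a::ring_1 \<Rightarrow> bool" where
  "ring_invertible a \<longleftrightarrow> (\<exists>b. a * b = 1 \<and> b * a = 1)"

definition ring_inverse :: "'a::ring_1 \<Rightarrow> 'a" where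
  "ring_inverse a = (THE b. a * b = 1 \<and> b * a = 1)"

lemma ring_inverse:
  assumes "ring_invertible a"
  shows "a * ring_inverse a = 1" and "ring_inverse a * a = 1"
proof -
  obtain b where b: "a * b = 1" "b * a = 1"
    using assms by (auto simp: ring_invertible_def)
  have "c = b" if "a * c = 1" "c * a = 1" for c
  proof -
    have "c = (b * a) * c" using b by simp
    also have "\<dots> = b" unfolding mult.assoc using that by simp
    finally show ?thesis .
  qed
  with b have "\<exists>!b. a * b = 1 \<and> b * a = 1" by auto
  from theI'[OF this] have "a * ring_inverse a = 1 \<and> ring_inverse a * a = 1"
    unfolding ring_inverse_def .
  then show "a * ring_inverse a = 1" and "ring_inverse a * a = 1" by auto
qed

definition inner_automorphism :: "'a::ring_1 \<Rightarrow> 'a \<Rightarrow> 'a" where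
  "inner_automorphism \<beta> f = \<beta> * f * ring_inverse \<beta>"

class locally_finite_order = order +
  assumes finite_interval: "finite {x..y}"

typedef (overloaded) ('x::order, 'k::zero) incidence =
  "{f :: 'x \<Rightarrow> 'x \<Rightarrow> 'k. \<forall>x y. \<not> x \<le> y \<longrightarrow> f x y = 0}"
  morphisms inc_app Abs_incidence
  by auto

setup_lifting type_definition_incidence

lemma inc_app_eq_0: "\<not> x \<le> y \<Longrightarrow> inc_app f x y = 0"
  using inc_app by blast

lemma incidence_eqI: "(\<And>x y. x \<le> y \<Longrightarrow> inc_app f x y = inc_app g x y) \<Longrightarrow> f = g"
  unfolding inc_app_inject[symmetric] fun_eq_iff using inc_app_eq_0 by metis

instantiation incidence :: (order, ab_group_add) ab_group_add
begin

lift_definition zero_incidence :: "('a, 'b) incidence" is "\<lambda>_ _. 0" by simp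

lift_definition plus_incidence :: "('a, 'b) incidence \<Rightarrow> ('a, 'b) incidence \<Rightarrow> ('a, 'b) incidence"
  is "\<lambda>f g x y. f x y + g x y" by simp

lift_definition minus_incidence :: "('a, 'b) incidence \<Rightarrow> ('a, 'b) incidence \<Rightarrow> ('a, 'b) incidence"
  is "\<lambda>f g x y. f x y - g x y" by simp

lift_definition uminus_incidence :: "('a, 'b) incidence \<Rightarrow> ('a, 'b) incidence"
  is "\<lambda>f x y. - f x y" by simp

instance
  by standard (transfer; simp add: fun_eq_iff algebra_simps)+

end

instantiation incidence :: (locally_finite_order, field) ring_1
begin

lift_definition one_incidence :: "('a, 'b) incidence" is "\<lambda>x y. if x = y then 1 else 0" by auto

lift_definition times_incidence :: "('a, 'b) incidence \<Rightarrow> ('a, 'b) incidence \<Rightarrow> ('a, 'b) incidence"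
  is "\<lambda>f g x y. \<Sum>z\<in>{x..y}. f x z * g z y"
  by auto

instance
proof
  fix a b c :: "('a, 'b) incidence"
  show "(a + b) * c = a * c + b * c"
    by transfer (simp add: fun_eq_iff algebra_simps sum.distrib)
  show "a * (b + c) = a * b + a * c"
    by transfer (simp add: fun_eq_iff algebra_simps sum.distrib)
  show "1 * a = a"
  proof (rule incidence_eqI)
    fix x y :: 'a assume "x \<le> y"
    have "inc_app (1 * a) x y = (\<Sum>z\<in>{x..y}. if x = z then inc_app a z y else 0)"
      unfolding times_incidence.rep_eq one_incidence.rep_eq by (intro sum.cong) auto
    with \<open>x \<le> y\<close> show "inc_app (1 * a) x y = inc_app a x y"
      by (simp add: finite_interval)
  qed
  show "a * 1 = a"
  proof (rule incidence_eqI)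
    fix x y :: 'a assume "x \<le> y"
    have "inc_app (a * 1) x y = (\<Sum>z\<in>{x..y}. if z = y then inc_app a x z else 0)"
      unfolding times_incidence.rep_eq one_incidence.rep_eq by (intro sum.cong) auto
    with \<open>x \<le> y\<close> show "inc_app (a * 1) x y = inc_app a x y"
      by (simp add: finite_interval)
  qed
  show "a * b * c = a * (b * c)"
  proof (rule incidence_eqI)
    fix x y :: 'a
    have "inc_app (a * b * c) x y =
        (\<Sum>z\<in>{x..y}. \<Sum>w\<in>{w\<in>{x..y}. w \<le> z}. inc_app a x w * inc_app b w z * inc_app c z y)"
      unfolding times_incidence.rep_eq sum_distrib_right
      by (intro sum.cong refl) (auto intro: order_trans)
    also have "\<dots> =
        (\<Sum>w\<in>{x..y}. \<Sum>z\<in>{z\<in>{x..y}. w \<le> z}. inc_app a x w * inc_app b w z * inc_app c z y)"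
      by (rule sum.swap_restrict) (auto simp: finite_interval)
    also have "\<dots> = inc_app (a * (b * c)) x y"
      unfolding times_incidence.rep_eq sum_distrib_left
      by (intro sum.cong refl) (auto intro: order_trans simp: mult.assoc)
    finally show "inc_app (a * b * c) x y = inc_app (a * (b * c)) x y" .
  qed
  show "(0 :: ('a, 'b) incidence) \<noteq> 1"
    by transfer (auto simp: fun_eq_iff)
qed

end

lift_definition inc_scale :: "'k::field \<Rightarrow> ('x::order, 'k) incidence \<Rightarrow> ('x, 'k) incidence"
  is "\<lambda>c f x y. c * f x y" by simp

lemma vector_space_inc_scale: "vector_space inc_scale"
  by standard (transfer; simp add: fun_eq_iff algebra_simps)+

lemma inc_scale_mult:
  fixes f g :: "('x::locally_finite_order, 'k::field) incidence"
  shows "inc_scale c f * g = inc_scale c (f * g)" and "f * inc_scale c g = inc_scale c (f * g)"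
  by (transfer; simp add: fun_eq_iff sum_distrib_left algebra_simps)+

definition inc_multiplicative :: "('x::order, 'k::field) incidence \<Rightarrow> bool" where
  "inc_multiplicative \<sigma> \<longleftrightarrow>
     (\<forall>x y. x \<le> y \<longrightarrow> inc_app \<sigma> x y \<noteq> 0) \<and>
     (\<forall>x y z. x \<le> y \<longrightarrow> y \<le> z \<longrightarrow> inc_app \<sigma> x z = inc_app \<sigma> x y * inc_app \<sigma> y z)"

lift_definition mult_automorphism ::
  "('x::order, 'k::field) incidence \<Rightarrow> ('x, 'k) incidence \<Rightarrow> ('x, 'k) incidence"
  is "\<lambda>\<sigma> f x y. \<sigma> x y * f x y" by simp

definition order_automorphism :: "('x::order \<Rightarrow> 'x) \<Rightarrow> bool" where
  "order_automorphism l \<longleftrightarrow> bij l \<and> (\<forall>x y. x \<le> y \<longleftrightarrow> l x \<le> l y)"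

text \<open>
  The guard \<open>x \<le> y\<close> makes the following total in \<open>l\<close>; for an order automorphism \<open>l\<close> it is redundant.
\<close>

lift_definition induced_automorphism ::
  "('x::order \<Rightarrow> 'x) \<Rightarrow> ('x, 'k::field) incidence \<Rightarrow> ('x, 'k) incidence"
  is "\<lambda>l f x y. if x \<le> y then f (inv l x) (inv l y) else 0" by simp

lemma inc_app_induced_automorphism:
  assumes "order_automorphism l"
  shows "inc_app (induced_automorphism l f) x y = inc_app f (inv l x) (inv l y)"
proof -
  have "inv l x \<le> inv l y \<longleftrightarrow> x \<le> y"
    using assms surj_f_inv_f[of l x] surj_f_inv_f[of l y]
    unfolding order_automorphism_def bij_def by metis
  then show ?thesis
    by (simp add: induced_automorphism.rep_eq inc_app_eq_0)
qed

text \<open>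
  Tuples are lists, and a function on a set of chains is represented by its extension by \<open>0\<close> to all
  lists.
\<close>

definition chains :: "nat \<Rightarrow> 'x::order list set" where
  "chains n = {xs. length xs = n \<and> sorted_wrt (\<le>) xs}"

definition cochains :: "nat \<Rightarrow> ('x::order list \<Rightarrow> 'k::field) set" where
  "cochains n = {f. \<forall>xs. xs \<notin> chains (n + 1) \<longrightarrow> f xs = 0}"

definition twisted_cochains :: "('x \<Rightarrow> 'x) \<Rightarrow> nat \<Rightarrow> ('x::order list \<Rightarrow> 'k::field) set" where
  "twisted_cochains l n =
     {f \<in> cochains n. \<forall>xs\<in>chains (n + 1). \<not> l (xs ! 0) \<le> xs ! n \<longrightarrow> f xs = 0}"

definition coboundary_map ::
  "('x::order, 'k::field) incidence \<Rightarrow> ('x \<Rightarrow> 'x) \<Rightarrow> nat \<Rightarrow> ('x list \<Rightarrow> 'k) \<Rightarrow> 'x list \<Rightarrow> 'k" where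
  "coboundary_map \<sigma> l n f = (\<lambda>xs.
     if xs \<in> chains (n + 2)
     then inc_app \<sigma> (l (xs ! 0)) (l (xs ! 1)) * f (tl xs)
          + (\<Sum>i=1..n+1. (-1) ^ i * f (take i xs @ drop (i + 1) xs))
     else 0)"

definition cocycles ::
  "('x::order, 'k::field) incidence \<Rightarrow> ('x \<Rightarrow> 'x) \<Rightarrow> nat \<Rightarrow> ('x list \<Rightarrow> 'k) set" where
  "cocycles \<sigma> l n = {f \<in> twisted_cochains l n. coboundary_map \<sigma> l n f = 0}"

text \<open>With \<open>B\<^sup>0 = 0\<close>, the quotient defining \<open>H\<^sup>0\<close> below is \<open>Z\<^sup>0 / 0\<close>, i.e. \<open>Z\<^sup>0\<close>.\<close>

primrec coboundaries ::
  "('x::order, 'k::field) incidence \<Rightarrow> ('x \<Rightarrow> 'x) \<Rightarrow> nat \<Rightarrow> ('x list \<Rightarrow> 'k) set" where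
  "coboundaries \<sigma> l 0 = {0}"
| "coboundaries \<sigma> l (Suc n) = coboundary_map \<sigma> l n ` twisted_cochains l n"

definition cohomology ::
  "('x::order, 'k::field) incidence \<Rightarrow> ('x \<Rightarrow> 'x) \<Rightarrow> nat \<Rightarrow> ('k, ('x list \<Rightarrow> 'k) set) kspace" where
  "cohomology \<sigma> l n = quotient_space (fun_scale (*)) (cocycles \<sigma> l n) (coboundaries \<sigma> l n)"

end

theory Submission
  imports Defs
begin

text \<open>
  Write \<open>\<psi>\<close> for the monomial part \<open>M\<^sub>\<sigma> \<circ> \<lambda>^\<close> of \<open>\<phi>\<close>. Left multiplication by \<open>\<beta>\<close> turns
  \<open>\<psi>\<close>-derivations into \<open>\<phi>\<close>-derivations and the inner derivation of \<open>a\<close> into that of \<open>\<beta>a\<close>, and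
  it is invertible. So the factor \<open>\<xi>\<^sub>\<beta>\<close> does not change the quotient, and only \<open>\<psi>\<close> has to be
  understood.

  The bridge to cohomology is the formula \<open>d\<^sub>f(b)(\<lambda>x, y) = f(x, y) b(x, y)\<close>. Comparing the
  coefficients of \<open>a(x, z) b(z, y)\<close> on the two sides of the twisted Leibniz rule for \<open>d\<^sub>f\<close> gives
  \<open>f(x, y) = f(x, z) + \<sigma>(\<lambda>x, \<lambda>z) f(z, y)\<close>, the cocycle identity; and \<open>d\<^sub>f(b)\<close> lies in the incidence
  algebra because \<open>f\<close> vanishes unless \<open>\<lambda>x \<le> y\<close>. This gives a linear map from cocycles to
  \<open>\<psi>\<close>-derivations, which induces the isomorphism for two reasons.

  First, every \<open>\<psi>\<close>-derivation is some \<open>d\<^sub>f\<close> plus an inner one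
  (\<open>twisted_derivation_decomposition\<close>). The values of \<open>d\<close> on the idempotents \<open>e\<^sub>v\<close> are always
  those of an inner derivation, so it suffices to consider \<open>d\<close> that kills all \<open>e\<^sub>v\<close>. Such a \<open>d\<close>
  commutes with cutting out corners: \<open>e\<^bsub>\<lambda>x\<^esub> d(b) e\<^sub>y = d(e\<^sub>x b e\<^sub>y) = b(x, y) d(e\<^bsub>xy\<^esub>)\<close>. So all entries of
  \<open>d(b)\<close> are determined by \<open>f(x, y) = d(e\<^bsub>xy\<^esub>)(\<lambda>x, y)\<close>, even when \<open>X\<close> is infinite and
  \<open>b\<close> is not a finite combination of matrix units.

  Second, \<open>d\<^sub>f\<close> is inner exactly when \<open>f\<close> is a coboundary (\<open>cochain_derivation_inner_iff\<close>): the
  inner derivation of \<open>a\<close> acts on \<open>e\<^bsub>xy\<^esub>\<close> at the place \<open>(\<lambda>x, y)\<close> through the entries \<open>a(\<lambda>x, x)\<close> and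
  \<open>a(\<lambda>y, y)\<close> alone, and these entries form, up to sign, a \<open>0\<close>-cochain with coboundary \<open>f\<close>.
\<close>

section \<open>Quotients of vector spaces\<close>

text \<open>
  The second isomorphism theorem, for a linear map that sends \<open>Z\<close> into \<open>V\<close> and meets every coset
  of \<open>W\<close> in \<open>V\<close>. Taking preimages of cosets describes the isomorphism \<open>V / W \<rightarrow> Z / B\<close> without choosing
  representatives.
\<close>

lemma isomorphic_quotient_spacesI:
  fixes s :: "'k::field \<Rightarrow> 'v::ab_group_add \<Rightarrow> 'v" and t :: "'k \<Rightarrow> 'w::ab_group_add \<Rightarrow> 'w"
  assumes \<Phi>: "Vector_Spaces.linear t s \<Phi>"
    and W: "module.subspace s W" and Z: "module.subspace t Z"
    and range: "\<Phi> ` Z \<subseteq> V"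
    and surj: "\<And>v. v \<in> V \<Longrightarrow> \<exists>z\<in>Z. v - \<Phi> z \<in> W"
    and ker: "Z \<inter> \<Phi> -` W = B"
  shows "isomorphic_spaces (quotient_space s V W) (quotient_space t Z B)"
proof -
  interpret Vector_Spaces.linear t s \<Phi> by fact
  note s = vs2.vector_space_axioms and t = vs1.vector_space_axioms
  have B: "module.subspace t B"
    using W Z unfolding ker[symmetric] vs1.subspace_def vs2.subspace_def
    by (auto simp: add scale zero)
  have coset: "x \<in> v +o W \<longleftrightarrow> x - v \<in> W" for x v
    by (auto simp: elt_set_plus_def intro: bexI[of _ "x - v"])
  have cosetB: "x \<in> v +o B \<longleftrightarrow> x - v \<in> B" for x v
    by (auto simp: elt_set_plus_def intro: bexI[of _ "x - v"])
  have coset_eq: "u +o W = v +o W" if "u - v \<in> W" for u v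
  proof -
    have "x - u \<in> W \<longleftrightarrow> x - v \<in> W" for x
      using vs2.subspace_add[OF W, of "x - u" "u - v"] vs2.subspace_diff[OF W, of "x - v" "u - v"] that
      by auto
    then show ?thesis by (auto simp: coset)
  qed
  define F where "F A = Z \<inter> \<Phi> -` A" for A
  have F: "F (v +o W) = z +o B" if "z \<in> Z" "v - \<Phi> z \<in> W" for v z
  proof -
    have "y \<in> F (v +o W) \<longleftrightarrow> y \<in> z +o B" for y
    proof -
      have "y \<in> F (v +o W) \<longleftrightarrow> y \<in> Z \<and> \<Phi> y \<in> \<Phi> z +o W"
        using coset_eq[OF that(2)] by (simp add: F_def)
      also have "\<dots> \<longleftrightarrow> y - z \<in> Z \<and> \<Phi> (y - z) \<in> W"
        using vs1.subspace_diff[OF Z, of y z] vs1.subspace_add[OF Z, of "y - z" z] that(1)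
        by (auto simp: coset diff)
      also have "\<dots> \<longleftrightarrow> y - z \<in> B"
        unfolding ker[symmetric] by simp
      finally show ?thesis by (simp only: cosetB)
    qed
    then show ?thesis by blast
  qed
  have F_image: "F (\<Phi> z +o W) = z +o B" if "z \<in> Z" for z
    using F[of z "\<Phi> z"] that vs2.subspace_0[OF W] by simp
  have repr: "\<exists>z\<in>Z. C = \<Phi> z +o W" if C: "C \<in> kcarrier (quotient_space s V W)" for C
  proof -
    obtain v where v: "v \<in> V" "C = v +o W" using C by (auto simp: quotient_space_def)
    then show ?thesis using surj[OF v(1)] coset_eq by blast
  qed
  have "bij_betw F (kcarrier (quotient_space s V W)) (kcarrier (quotient_space t Z B))"
  proof (rule bij_betwI')
    fix C D assume "C \<in> kcarrier (quotient_space s V W)" "D \<in> kcarrier (quotient_space s V W)"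
    then obtain y z where yz: "y \<in> Z" "C = \<Phi> y +o W" "z \<in> Z" "D = \<Phi> z +o W"
      using repr by meson
    have "C = D" if "y +o B = z +o B"
    proof -
      have "y - z \<in> B" using that cosetB vs1.subspace_0[OF B] by (metis diff_self)
      then have "\<Phi> y - \<Phi> z \<in> W" by (auto simp: diff simp flip: ker)
      then show ?thesis using yz coset_eq by simp
    qed
    then show "F C = F D \<longleftrightarrow> C = D" using yz F_image by metis
  next
    fix C assume "C \<in> kcarrier (quotient_space s V W)"
    then show "F C \<in> kcarrier (quotient_space t Z B)"
      using repr[of C] F_image by (auto simp: quotient_space_def)
  next
    fix D assume "D \<in> kcarrier (quotient_space t Z B)"
    then obtain z where "z \<in> Z" "D = z +o B" by (auto simp: quotient_space_def)
    then show "\<exists>C\<in>kcarrier (quotient_space s V W). D = F C"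
      using range F_image by (intro bexI[of _ "\<Phi> z +o W"]) (auto simp: quotient_space_def)
  qed
  moreover have "F (kadd (quotient_space s V W) C D) = kadd (quotient_space t Z B) (F C) (F D)"
    if CD: "C \<in> kcarrier (quotient_space s V W)" "D \<in> kcarrier (quotient_space s V W)" for C D
  proof -
    obtain y z where yz: "y \<in> Z" "C = \<Phi> y +o W" "z \<in> Z" "D = \<Phi> z +o W"
      using CD repr by meson
    then show ?thesis
      using F_image[of "y + z"] vs1.subspace_add[OF Z]
      by (simp add: F_image quotient_space_simps[OF s W] quotient_space_simps[OF t B] add)
  qed
  moreover have "F (kscale (quotient_space s V W) c C) = kscale (quotient_space t Z B) c (F C)"
    if C: "C \<in> kcarrier (quotient_space s V W)" for c C
  proof -
    obtain z where z: "z \<in> Z" "C = \<Phi> z +o W"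
      using C repr by meson
    then show ?thesis
      using F_image[of "t c z"] vs1.subspace_scale[OF Z]
      by (simp add: F_image quotient_space_simps[OF s W] quotient_space_simps[OF t B] scale)
  qed
  ultimately show ?thesis unfolding isomorphic_spaces_def by blast
qed

section \<open>Twisted derivations\<close>

lemma linear_left_mult:
  fixes s :: "'k::field \<Rightarrow> 'a::ring_1 \<Rightarrow> 'a"
  assumes "vector_space s" and "\<And>c a b. a * s c b = s c (a * b)"
  shows "Vector_Spaces.linear s s ((*) a)"
  using assms by (simp add: Vector_Spaces.linear_iff distrib_left)

text \<open>
  Multiplying \<open>d(ab) = d(a) b + \<psi>(a) d(b)\<close> by \<open>\<beta>\<close> from the left and inserting \<open>\<beta>\<^sup>-\<^sup>1\<beta>\<close> before
  \<open>d(b)\<close> gives the Leibniz rule of \<open>\<beta>d\<close> for \<open>\<xi>\<^sub>\<beta> \<circ> \<psi>\<close>; multiplication by \<open>\<beta>\<^sup>-\<^sup>1\<close> leads back.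
\<close>

lemma twisted_derivations_inner_automorphism:
  fixes s :: "'k::field \<Rightarrow> 'a::ring_1 \<Rightarrow> 'a"
  assumes \<beta>: "ring_invertible \<beta>"
    and s: "vector_space s" "\<And>c a b. a * s c b = s c (a * b)"
  shows "twisted_derivations s (inner_automorphism \<beta> \<circ> \<psi>) =
           (\<lambda>d b. \<beta> * d b) ` twisted_derivations s \<psi>"
proof (intro set_eqI iffI)
  let ?\<beta>' = "ring_inverse \<beta>"
  have cancel: "\<beta> * (?\<beta>' * a) = a" "?\<beta>' * (\<beta> * a) = a" for a
    using ring_inverse[OF \<beta>] by (simp_all flip: mult.assoc)
  have lin: "Vector_Spaces.linear s s (\<lambda>b. a * d b)" if "Vector_Spaces.linear s s d" for a d
    using Vector_Spaces.linear_compose[OF that linear_left_mult[OF s]] by (simp add: comp_def)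
  {
    fix d assume "d \<in> twisted_derivations s (inner_automorphism \<beta> \<circ> \<psi>)"
    then have "(\<lambda>b. ?\<beta>' * d b) \<in> twisted_derivations s \<psi>"
      using lin by (auto simp: twisted_derivations_def inner_automorphism_def distrib_left mult.assoc cancel)
    then show "d \<in> (\<lambda>d b. \<beta> * d b) ` twisted_derivations s \<psi>"
      by (rule rev_image_eqI) (simp add: cancel)
  next
    fix d assume "d \<in> (\<lambda>d b. \<beta> * d b) ` twisted_derivations s \<psi>"
    then show "d \<in> twisted_derivations s (inner_automorphism \<beta> \<circ> \<psi>)"
      using lin by (auto simp: twisted_derivations_def inner_automorphism_def distrib_left mult.assoc cancel)
  }
qed

text \<open>
  The same computation matches the inner derivation of \<open>a\<close> for \<open>\<psi>\<close> with that of \<open>\<beta>a\<close>.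
\<close>

lemma inner_twisted_derivations_inner_automorphism:
  assumes \<beta>: "ring_invertible \<beta>"
  shows "inner_twisted_derivations (inner_automorphism \<beta> \<circ> \<psi>) =
           (\<lambda>d b. \<beta> * d b) ` inner_twisted_derivations \<psi>"
proof (intro set_eqI iffI)
  let ?\<beta>' = "ring_inverse \<beta>"
  have cancel: "\<beta> * (?\<beta>' * a) = a" "?\<beta>' * (\<beta> * a) = a" for a
    using ring_inverse[OF \<beta>] by (simp_all flip: mult.assoc)
  {
    fix d assume "d \<in> inner_twisted_derivations (inner_automorphism \<beta> \<circ> \<psi>)"
    then obtain a where d: "d = (\<lambda>b. a * b - \<beta> * \<psi> b * ?\<beta>' * a)"
      by (auto simp: inner_twisted_derivations_def inner_automorphism_def)
    have "(\<lambda>b. (?\<beta>' * a) * b - \<psi> b * (?\<beta>' * a)) \<in> inner_twisted_derivations \<psi>"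
      by (simp add: inner_twisted_derivations_def)
    then show "d \<in> (\<lambda>d b. \<beta> * d b) ` inner_twisted_derivations \<psi>"
      by (rule rev_image_eqI) (simp add: d fun_eq_iff right_diff_distrib mult.assoc cancel)
  next
    fix d assume "d \<in> (\<lambda>d b. \<beta> * d b) ` inner_twisted_derivations \<psi>"
    then obtain a where d: "d = (\<lambda>b. \<beta> * (a * b - \<psi> b * a))"
      by (auto simp: inner_twisted_derivations_def)
    then have "d = (\<lambda>b. (\<beta> * a) * b - (inner_automorphism \<beta> \<circ> \<psi>) b * (\<beta> * a))"
      by (simp add: fun_eq_iff inner_automorphism_def right_diff_distrib mult.assoc cancel)
    then show "d \<in> inner_twisted_derivations (inner_automorphism \<beta> \<circ> \<psi>)"
      by (simp add: inner_twisted_derivations_def)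
  }
qed

lemma subspace_inner_twisted_derivations:
  fixes s :: "'k::field \<Rightarrow> 'a::ring_1 \<Rightarrow> 'a"
  assumes s: "vector_space s" "\<And>c a b. s c a * b = s c (a * b)" "\<And>c a b. a * s c b = s c (a * b)"
  shows "module.subspace (fun_scale s) (inner_twisted_derivations \<phi>)"
proof -
  interpret vector_space s by fact
  interpret F: vector_space "fun_scale s" by (rule vector_space_fun_scale) fact
  define D where "D a = (\<lambda>b. a * b - \<phi> b * a)" for a
  have D: "D 0 = 0" "D (x + y) = D x + D y" "D (s c x) = fun_scale s c (D x)" for x y c
    by (simp_all add: D_def fun_eq_iff fun_scale_def algebra_simps s)
  have "F.subspace (range D)"
  proof (rule F.subspaceI)
    show "0 \<in> range D" using D(1) by (metis rangeI)
    show "d + e \<in> range D" if "d \<in> range D" "e \<in> range D" for d e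
      using that by (auto simp flip: D)
    show "fun_scale s c d \<in> range D" if "d \<in> range D" for c d
      using that by (auto simp flip: D)
  qed
  then show ?thesis by (simp add: D_def[abs_def] inner_twisted_derivations_def)
qed

section \<open>Matrix units\<close>

lift_definition matrix_unit :: "'x::order \<Rightarrow> 'x \<Rightarrow> ('x, 'k::field) incidence"
  is "\<lambda>x y u v. if u = x \<and> v = y \<and> x \<le> y then 1 else 0" by auto

lemma inc_app_matrix_unit_mult:
  fixes a :: "('x::locally_finite_order, 'k::field) incidence"
  assumes "x \<le> y"
  shows "inc_app (matrix_unit x y * a) u v = (if u = x then inc_app a y v else 0)"
proof -
  have "inc_app (matrix_unit x y * a) u v =
      (\<Sum>z\<in>{u..v}. if z = y then if u = x then inc_app a y v else 0 else 0)"
    unfolding times_incidence.rep_eq matrix_unit.rep_eq using assms by (intro sum.cong) auto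
  then show ?thesis
    using assms by (auto simp: finite_interval inc_app_eq_0)
qed

lemma inc_app_mult_matrix_unit:
  fixes a :: "('x::locally_finite_order, 'k::field) incidence"
  assumes "x \<le> y"
  shows "inc_app (a * matrix_unit x y) u v = (if v = y then inc_app a u x else 0)"
proof -
  have "inc_app (a * matrix_unit x y) u v =
      (\<Sum>z\<in>{u..v}. if z = x then if v = y then inc_app a u x else 0 else 0)"
    unfolding times_incidence.rep_eq matrix_unit.rep_eq using assms by (intro sum.cong) auto
  then show ?thesis
    using assms by (auto simp: finite_interval inc_app_eq_0)
qed

lemma matrix_unit_mult_matrix_unit:
  fixes x y z :: "'x::locally_finite_order"
  assumes "x \<le> y" "y \<le> z"
  shows "matrix_unit x y * matrix_unit y z = (matrix_unit x z :: ('x, 'k::field) incidence)"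
  by (rule incidence_eqI)
     (use assms in \<open>auto simp: inc_app_matrix_unit_mult matrix_unit.rep_eq\<close>)

lemma matrix_unit_mult_matrix_unit_eq_0:
  fixes v w :: "'x::locally_finite_order"
  assumes "v \<noteq> w"
  shows "matrix_unit v v * matrix_unit w w = (0 :: ('x, 'k::field) incidence)"
  by (rule incidence_eqI)
     (use assms in \<open>auto simp: inc_app_matrix_unit_mult matrix_unit.rep_eq zero_incidence.rep_eq\<close>)

text \<open>
  Cutting out one entry produces a multiple of a matrix unit for every \<open>b\<close>, also one of infinite
  support. This is what lets a linear map be controlled by its values on matrix units.
\<close>

lemma matrix_unit_corner:
  fixes b :: "('x::locally_finite_order, 'k::field) incidence"
  shows "matrix_unit x x * b * matrix_unit y y = inc_scale (inc_app b x y) (matrix_unit x y)"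
  by (rule incidence_eqI)
     (auto simp: inc_app_matrix_unit_mult inc_app_mult_matrix_unit matrix_unit.rep_eq inc_scale.rep_eq)

lemma vector_space_field: "vector_space ((*) :: 'k::field \<Rightarrow> 'k \<Rightarrow> 'k)"
  by standard (simp_all add: algebra_simps)

section \<open>Cocycles and coboundaries in low degree\<close>

lemma chains_1: "xs \<in> chains (Suc 0) \<longleftrightarrow> (\<exists>x. xs = [x])"
  by (auto simp: chains_def length_Suc_conv)

lemma chains_2: "xs \<in> chains 2 \<longleftrightarrow> (\<exists>x y. xs = [x, y] \<and> x \<le> y)"
  by (auto simp: chains_def length_Suc_conv numeral_eq_Suc)

lemma chains_3: "xs \<in> chains 3 \<longleftrightarrow> (\<exists>x y z. xs = [x, y, z] \<and> x \<le> y \<and> y \<le> z)"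
  by (auto simp: chains_def length_Suc_conv numeral_eq_Suc intro: order_trans)

lemma coboundary_map_0:
  "coboundary_map \<sigma> l 0 g xs =
     (if xs \<in> chains 2 then inc_app \<sigma> (l (xs ! 0)) (l (xs ! 1)) * g (tl xs) - g [xs ! 0] else 0)"
  by (auto simp: coboundary_map_def chains_2 simp flip: numeral_2_eq_2)

lemma coboundary_map_1:
  assumes "x \<le> y" "y \<le> z"
  shows "coboundary_map \<sigma> l 1 f [x, y, z] =
           inc_app \<sigma> (l x) (l y) * f [y, z] - f [x, z] + f [x, y]"
proof -
  have "[x, y, z] \<in> chains 3" using assms by (simp add: chains_3)
  moreover have "{1..2} = {1, 2::nat}" by auto
  ultimately show ?thesis
    by (simp add: coboundary_map_def numeral_3_eq_3 numeral_2_eq_2)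
qed

text \<open>
  The vanishing conditions of a twisted cochain merge into one condition on its support, in addition
  to which only the identity on triples \<open>x \<le> y \<le> z\<close> remains.
\<close>

lemma cocycles_1_iff:
  "f \<in> cocycles \<sigma> l 1 \<longleftrightarrow>
     (\<forall>xs. f xs \<noteq> 0 \<longrightarrow> (\<exists>x y. xs = [x, y] \<and> x \<le> y \<and> l x \<le> y)) \<and>
     (\<forall>x y z. x \<le> y \<longrightarrow> y \<le> z \<longrightarrow> f [x, z] = f [x, y] + inc_app \<sigma> (l x) (l y) * f [y, z])"
  (is "_ \<longleftrightarrow> ?supp \<and> ?eq")
proof -
  have "f \<in> twisted_cochains l 1 \<longleftrightarrow>
      (\<forall>xs. f xs \<noteq> 0 \<longrightarrow> xs \<in> chains 2 \<and> l (xs ! 0) \<le> xs ! 1)"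
    unfolding twisted_cochains_def cochains_def one_add_one by blast
  moreover have "xs \<in> chains 2 \<and> l (xs ! 0) \<le> xs ! 1 \<longleftrightarrow>
      (\<exists>x y. xs = [x, y] \<and> x \<le> y \<and> l x \<le> y)" for xs
    by (auto simp: chains_2)
  ultimately have "f \<in> twisted_cochains l 1 \<longleftrightarrow> ?supp" by simp
  moreover have "coboundary_map \<sigma> l 1 f = 0 \<longleftrightarrow> ?eq"
  proof -
    have "coboundary_map \<sigma> l 1 f xs = 0" if "xs \<notin> chains 3" for xs
      using that by (simp add: coboundary_map_def numeral_3_eq_3)
    then have "coboundary_map \<sigma> l 1 f = 0 \<longleftrightarrow>
        (\<forall>xs\<in>chains 3. coboundary_map \<sigma> l 1 f xs = 0)"
      unfolding fun_eq_iff zero_fun_def by blast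
    also have "\<dots> \<longleftrightarrow> (\<forall>x y z. x \<le> y \<longrightarrow> y \<le> z \<longrightarrow> coboundary_map \<sigma> l 1 f [x, y, z] = 0)"
      by (auto simp: chains_3)
    also have "\<dots> \<longleftrightarrow> ?eq"
    proof -
      have "p - q + r = 0 \<longleftrightarrow> q = r + p" for p q r :: 'b
        using eq_iff_diff_eq_0[of q "r + p"] by (auto simp: algebra_simps)
      then show ?thesis by (simp add: coboundary_map_1 del: One_nat_def)
    qed
    finally show ?thesis .
  qed
  ultimately show ?thesis by (simp add: cocycles_def)
qed

lemma cocycles_1_support:
  "f \<in> cocycles \<sigma> l 1 \<Longrightarrow> f xs \<noteq> 0 \<Longrightarrow> \<exists>x y. xs = [x, y] \<and> x \<le> y \<and> l x \<le> y"
  by (rule cocycles_1_iff[THEN iffD1, THEN conjunct1, rule_format])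

lemma cocycles_1_eq:
  "f \<in> cocycles \<sigma> l 1 \<Longrightarrow> x \<le> y \<Longrightarrow> y \<le> z \<Longrightarrow>
     f [x, z] = f [x, y] + inc_app \<sigma> (l x) (l y) * f [y, z]"
  by (rule cocycles_1_iff[THEN iffD1, THEN conjunct2, rule_format])

lemma coboundaries_1E:
  assumes "f \<in> coboundaries \<sigma> l 1"
  obtains g where "\<And>xs. xs \<notin> chains 2 \<Longrightarrow> f xs = 0"
    and "\<And>x. g x \<noteq> 0 \<Longrightarrow> l x \<le> x"
    and "\<And>x y. x \<le> y \<Longrightarrow> f [x, y] = inc_app \<sigma> (l x) (l y) * g y - g x"
proof -
  obtain h where h: "h \<in> twisted_cochains l 0" and f: "f = coboundary_map \<sigma> l 0 h"
    using assms by auto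
  show ?thesis
  proof (rule that)
    show "f xs = 0" if "xs \<notin> chains 2" for xs
      using that by (simp add: f coboundary_map_0)
    show "l x \<le> x" if "h [x] \<noteq> 0" for x
      using h that by (force simp: twisted_cochains_def chains_1)
    show "f [x, y] = inc_app \<sigma> (l x) (l y) * h [y] - h [x]" if "x \<le> y" for x y
      using that by (simp add: f coboundary_map_0 chains_2)
  qed
qed

lemma coboundaries_1I:
  assumes supp: "\<And>xs. xs \<notin> chains 2 \<Longrightarrow> f xs = 0"
    and g: "\<And>x. g x \<noteq> 0 \<Longrightarrow> l x \<le> x"
    and f: "\<And>x y. x \<le> y \<Longrightarrow> f [x, y] = inc_app \<sigma> (l x) (l y) * g y - g x"
  shows "f \<in> coboundaries \<sigma> l 1"
proof -
  define h where "h xs = (if xs \<in> chains 1 then g (hd xs) else 0)" for xs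
  have "g x = 0" if "\<not> l x \<le> x" for x
    using g that by blast
  then have "h \<in> twisted_cochains l 0"
    by (auto simp: twisted_cochains_def cochains_def h_def chains_1)
  moreover have "f = coboundary_map \<sigma> l 0 h"
  proof
    show "f xs = coboundary_map \<sigma> l 0 h xs" for xs
      by (cases "xs \<in> chains 2") (auto simp: supp f coboundary_map_0 h_def chains_1 chains_2)
  qed
  ultimately show ?thesis by auto
qed

lemma subspace_cocycles_1:
  fixes \<sigma> :: "('x::order, 'k::field) incidence"
  shows "module.subspace (fun_scale (*)) (cocycles \<sigma> l 1)"
proof -
  interpret vector_space "fun_scale (*) :: 'k \<Rightarrow> ('x list \<Rightarrow> 'k) \<Rightarrow> 'x list \<Rightarrow> 'k"
    by (rule vector_space_fun_scale) (rule vector_space_field)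
  show ?thesis
  proof (rule subspaceI)
    show "0 \<in> cocycles \<sigma> l 1"
      by (simp add: cocycles_1_iff del: One_nat_def)
  next
    fix f g assume f: "f \<in> cocycles \<sigma> l 1" and g: "g \<in> cocycles \<sigma> l 1"
    show "f + g \<in> cocycles \<sigma> l 1"
      unfolding cocycles_1_iff
    proof (intro conjI allI impI)
      fix xs assume "(f + g) xs \<noteq> 0"
      then have "f xs \<noteq> 0 \<or> g xs \<noteq> 0" by auto
      then show "\<exists>x y. xs = [x, y] \<and> x \<le> y \<and> l x \<le> y"
        by (elim disjE) (rule cocycles_1_support[OF f] cocycles_1_support[OF g], assumption)+
    next
      fix x y z :: 'x assume le: "x \<le> y" "y \<le> z"
      show "(f + g) [x, z] = (f + g) [x, y] + inc_app \<sigma> (l x) (l y) * (f + g) [y, z]"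
        using cocycles_1_eq[OF f le] cocycles_1_eq[OF g le] by (simp add: algebra_simps)
    qed
  next
    fix c f assume f: "f \<in> cocycles \<sigma> l 1"
    show "fun_scale (*) c f \<in> cocycles \<sigma> l 1"
      unfolding cocycles_1_iff
    proof (intro conjI allI impI)
      fix xs assume "fun_scale (*) c f xs \<noteq> 0"
      then have "f xs \<noteq> 0" by (auto simp: fun_scale_def)
      then show "\<exists>x y. xs = [x, y] \<and> x \<le> y \<and> l x \<le> y"
        by (rule cocycles_1_support[OF f])
    next
      fix x y z :: 'x assume "x \<le> y" "y \<le> z"
      then have "f [x, z] = f [x, y] + inc_app \<sigma> (l x) (l y) * f [y, z]"
        by (rule cocycles_1_eq[OF f])
      then show "fun_scale (*) c f [x, z] =
          fun_scale (*) c f [x, y] + inc_app \<sigma> (l x) (l y) * fun_scale (*) c f [y, z]"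
        by (simp add: fun_scale_def algebra_simps)
    qed
  qed
qed

section \<open>Derivations twisted by a monomial automorphism\<close>

locale monomial_twist =
  fixes \<sigma> :: "('x::locally_finite_order, 'k::field) incidence" and l :: "'x \<Rightarrow> 'x"
  assumes multiplicative: "inc_multiplicative \<sigma>" and automorphism: "order_automorphism l"
begin

definition \<psi> :: "('x, 'k) incidence \<Rightarrow> ('x, 'k) incidence" where
  "\<psi> = mult_automorphism \<sigma> \<circ> induced_automorphism l"

lemma l_le_iff [simp]: "l x \<le> l y \<longleftrightarrow> x \<le> y"
  using automorphism by (simp add: order_automorphism_def)

lemma l_eq_iff [simp]: "l x = l y \<longleftrightarrow> x = y"
  by (simp add: order_eq_iff)

lemma inv_l [simp]: "inv l (l x) = x"
  by (simp add: inj_def)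

lemma surj_l: "surj l"
  using automorphism by (simp add: order_automorphism_def bij_def)

lemma l_inv [simp]: "l (inv l x) = x"
  by (rule surj_f_inv_f[OF surj_l])

lemma l_cases: obtains x where "u = l x"
  by (metis l_inv)

lemma \<sigma>_refl: "inc_app \<sigma> x x = 1"
  using multiplicative unfolding inc_multiplicative_def
  by (metis mult_cancel_left2 order_refl)

lemma \<sigma>_trans: "x \<le> y \<Longrightarrow> y \<le> z \<Longrightarrow> inc_app \<sigma> x z = inc_app \<sigma> x y * inc_app \<sigma> y z"
  using multiplicative unfolding inc_multiplicative_def by blast

lemma inc_app_\<psi> [simp]: "inc_app (\<psi> b) (l x) (l y) = inc_app \<sigma> (l x) (l y) * inc_app b x y"
  by (simp add: \<psi>_def mult_automorphism.rep_eq inc_app_induced_automorphism[OF automorphism])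

text \<open>
  Rows are indexed by \<open>l x\<close> from here on: the formulas for \<open>\<psi>\<close> and for the derivations of
  cocycles are then free of the inverse of \<open>l\<close>.
\<close>

lemma incidence_eqI':
  assumes "\<And>x y. inc_app f (l x) y = inc_app g (l x) y"
  shows "f = g"
  by (rule incidence_eqI) (metis assms l_inv)

lemma inc_app_\<psi>_mult:
  "inc_app (\<psi> a * b) (l x) y =
     (\<Sum>z\<in>{x..inv l y}. inc_app \<sigma> (l x) (l z) * inc_app a x z * inc_app b (l z) y)"
proof -
  have "{l x..y} = l ` {x..inv l y}"
  proof (intro set_eqI iffI)
    fix u assume "u \<in> {l x..y}"
    moreover obtain z where "u = l z" by (rule l_cases)
    moreover obtain w where "y = l w" by (rule l_cases)
    ultimately show "u \<in> l ` {x..inv l y}" by auto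
  next
    fix u assume "u \<in> l ` {x..inv l y}"
    moreover obtain w where "y = l w" by (rule l_cases)
    ultimately show "u \<in> {l x..y}" by auto
  qed
  then show ?thesis
    by (simp add: times_incidence.rep_eq sum.reindex inj_on_def)
qed

text \<open>
  Because \<open>l\<close> maps the interval from \<open>x\<close> to \<open>y\<close> onto the one from \<open>l x\<close> to \<open>l y\<close>, the two
  convolution sums have the same index set, and \<open>\<sigma>(l x, l y)\<close> factors through every index.
\<close>

lemma \<psi>_mult: "\<psi> (a * b) = \<psi> a * \<psi> b"
proof (rule incidence_eqI')
  fix x u
  obtain y where u: "u = l y" by (rule l_cases)
  show "inc_app (\<psi> (a * b)) (l x) u = inc_app (\<psi> a * \<psi> b) (l x) u"
    unfolding u inc_app_\<psi>_mult
    by (simp add: times_incidence.rep_eq sum_distrib_left)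
       (intro sum.cong refl; simp add: \<sigma>_trans[of "l x" "l _" "l y"])
qed

lemma \<psi>_linear: "\<psi> (a + b) = \<psi> a + \<psi> b" "\<psi> (inc_scale c a) = inc_scale c (\<psi> a)"
  unfolding \<psi>_def comp_def by (transfer; simp add: fun_eq_iff algebra_simps)+

lemma \<psi>_matrix_unit:
  "\<psi> (matrix_unit x y) = inc_scale (inc_app \<sigma> (l x) (l y)) (matrix_unit (l x) (l y))"
proof (rule incidence_eqI')
  fix u v
  obtain w where "v = l w" by (rule l_cases)
  then show "inc_app (\<psi> (matrix_unit x y)) (l u) v =
      inc_app (inc_scale (inc_app \<sigma> (l x) (l y)) (matrix_unit (l x) (l y))) (l u) v"
    by (auto simp: matrix_unit.rep_eq inc_scale.rep_eq)
qed

lemma \<psi>_idempotent: "\<psi> (matrix_unit x x) = matrix_unit (l x) (l x)"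
  using vector_space.vector_space_assms(4)[OF vector_space_inc_scale]
  by (simp add: \<psi>_matrix_unit \<sigma>_refl)

lemma inner_in_twisted_derivations:
  "(\<lambda>b. a * b - \<psi> b * a) \<in> twisted_derivations inc_scale \<psi>"
proof -
  interpret vector_space "inc_scale :: 'k \<Rightarrow> ('x, 'k) incidence \<Rightarrow> _"
    by (rule vector_space_inc_scale)
  show ?thesis
    by (auto simp: twisted_derivations_def Vector_Spaces.linear_iff vector_space_axioms
        \<psi>_linear \<psi>_mult inc_scale_mult scale_right_diff_distrib algebra_simps)
qed

text \<open>
  The derivation \<open>d\<^sub>f\<close> with \<open>d\<^sub>f(b)(l x, y) = f(x, y) b(x, y)\<close>. The guard keeps the values in
  the incidence algebra for every \<open>f\<close>, so that the construction is linear in \<open>f\<close> on a whole type;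
  for cocycles it never cuts off a nonzero value.
\<close>

lift_definition cochain_derivation ::
  "('x list \<Rightarrow> 'k) \<Rightarrow> ('x, 'k) incidence \<Rightarrow> ('x, 'k) incidence"
  is "\<lambda>f b u y. if u \<le> y then f [inv l u, y] * b (inv l u) y else 0" by simp

lemma inc_app_cochain_derivation:
  assumes "f \<in> cocycles \<sigma> l 1"
  shows "inc_app (cochain_derivation f b) (l x) y = f [x, y] * inc_app b x y"
proof -
  have "f [x, y] = 0" if "\<not> l x \<le> y"
    using cocycles_1_support[OF assms, of "[x, y]"] that by auto
  then show ?thesis by (auto simp: cochain_derivation.rep_eq)
qed

lemma linear_cochain_derivation:
  "cochain_derivation (f + g) b = cochain_derivation f b + cochain_derivation g b"
  "cochain_derivation (fun_scale (*) c f) b = inc_scale c (cochain_derivation f b)"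
  "cochain_derivation f (a + b) = cochain_derivation f a + cochain_derivation f b"
  "cochain_derivation f (inc_scale c b) = inc_scale c (cochain_derivation f b)"
  by (transfer; simp add: fun_eq_iff fun_scale_def algebra_simps)+

text \<open>
  The cocycle identity, multiplied by \<open>a(x, z) b(z, y)\<close> and summed over \<open>x \<le> z \<le> y\<close>, is the
  Leibniz rule. The convolutions in the rule run over other intervals (\<open>l x \<le> z \<le> y\<close> and
  \<open>x \<le> z\<close>, \<open>l z \<le> y\<close>), but the summands that differ vanish by the support condition on \<open>f\<close>.
\<close>

lemma cochain_derivation_in_twisted_derivations:
  assumes f: "f \<in> cocycles \<sigma> l 1"
  shows "cochain_derivation f \<in> twisted_derivations inc_scale \<psi>"
proof -
  let ?d = "cochain_derivation f"
  note app = inc_app_cochain_derivation[OF f]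
  have supp: "f [x, y] = 0" if "\<not> l x \<le> y" for x y
    using cocycles_1_support[OF f, of "[x, y]"] that by auto
  have coc: "f [x, z] = f [x, y] + inc_app \<sigma> (l x) (l y) * f [y, z]" if "x \<le> y" "y \<le> z" for x y z
    using f that by (rule cocycles_1_eq)
  have "?d (a * b) = ?d a * b + \<psi> a * ?d b" for a b
  proof (rule incidence_eqI')
    fix x y
    have "inc_app (?d (a * b)) (l x) y =
        (\<Sum>z\<in>{x..y}. f [x, y] * (inc_app a x z * inc_app b z y))"
      by (simp add: app times_incidence.rep_eq sum_distrib_left)
    also have "\<dots> = (\<Sum>z\<in>{x..y}. f [x, z] * inc_app a x z * inc_app b z y)
        + (\<Sum>z\<in>{x..y}. inc_app \<sigma> (l x) (l z) * inc_app a x z * (f [z, y] * inc_app b z y))"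
      unfolding sum.distrib[symmetric]
      by (intro sum.cong refl) (auto simp: coc[of x _ y] algebra_simps)
    also have "(\<Sum>z\<in>{x..y}. f [x, z] * inc_app a x z * inc_app b z y) = inc_app (?d a * b) (l x) y"
      unfolding times_incidence.rep_eq app
      by (intro sum.mono_neutral_cong finite_interval refl) (auto simp: supp inc_app_eq_0)
    also have "(\<Sum>z\<in>{x..y}. inc_app \<sigma> (l x) (l z) * inc_app a x z * (f [z, y] * inc_app b z y)) =
        inc_app (\<psi> a * ?d b) (l x) y"
    proof -
      have "z \<le> inv l y \<longleftrightarrow> l z \<le> y" for z
        using l_le_iff[of z "inv l y"] by simp
      then show ?thesis
        unfolding inc_app_\<psi>_mult app
        by (intro sum.mono_neutral_cong finite_interval refl) (auto simp: supp inc_app_eq_0)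
    qed
    finally show "inc_app (?d (a * b)) (l x) y = inc_app (?d a * b + \<psi> a * ?d b) (l x) y"
      by (simp add: plus_incidence.rep_eq)
  qed
  then show ?thesis
    by (simp add: twisted_derivations_def Vector_Spaces.linear_iff vector_space_inc_scale
        linear_cochain_derivation)
qed

text \<open>
  The inner derivation of \<open>a\<close> moves column \<open>x\<close> of \<open>a\<close> to column \<open>y\<close> and subtracts a multiple of
  row \<open>l y\<close> moved to row \<open>l x\<close>.
\<close>

lemma inc_app_inner_matrix_unit:
  "x \<le> y \<Longrightarrow> inc_app (a * matrix_unit x y - \<psi> (matrix_unit x y) * a) u v =
     (if v = y then inc_app a u x else 0)
     - (if u = l x then inc_app \<sigma> (l x) (l y) * inc_app a (l y) v else 0)"
  by (simp add: minus_incidence.rep_eq inc_app_mult_matrix_unit \<psi>_matrix_unit inc_scale_mult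
      inc_scale.rep_eq inc_app_matrix_unit_mult)

text \<open>
  The relations \<open>e\<^sub>v e\<^sub>v = e\<^sub>v\<close> and \<open>e\<^sub>v e\<^sub>w = 0\<close> confine \<open>d(e\<^sub>v)\<close> to column \<open>v\<close> and row
  \<open>l v\<close>, and they express the row through the columns of the other \<open>d(e\<^sub>w)\<close>. Assembling all
  these columns into one element \<open>a\<close> therefore accounts for the columns and the rows at once.
\<close>

lemma agrees_with_inner_on_idempotents:
  assumes d: "d \<in> twisted_derivations inc_scale \<psi>"
  shows "\<exists>a. \<forall>v. d (matrix_unit v v) = a * matrix_unit v v - \<psi> (matrix_unit v v) * a"
proof -
  interpret Vector_Spaces.linear inc_scale inc_scale d
    using d by (simp add: twisted_derivations_def)
  have leibniz: "d (p * q) = d p * q + \<psi> p * d q" for p q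
    using d by (simp add: twisted_derivations_def)
  define c where "c v = inc_app (d (matrix_unit v v))" for v
  have diag: "c v u w = (if w = v then c v u v else 0) + (if u = l v then c v (l v) w else 0)" for u v w
    using arg_cong[OF leibniz[of "matrix_unit v v" "matrix_unit v v"], of "\<lambda>f. inc_app f u w"]
    by (simp add: c_def matrix_unit_mult_matrix_unit \<psi>_idempotent plus_incidence.rep_eq
        inc_app_matrix_unit_mult inc_app_mult_matrix_unit)
  \<comment> \<open>row \<open>l v\<close> and column \<open>v\<close> cross here, so the entry equals its own double\<close>
  have diag0: "c v (l v) v = 0" for v
    using diag[of v "l v" v] by (simp only: refl if_True add_cancel_right_right)
  have off: "c v (l v) w + c w (l v) w = 0" if "v \<noteq> w" for v w
    using arg_cong[OF leibniz[of "matrix_unit v v" "matrix_unit w w"], of "\<lambda>f. inc_app f (l v) w"] that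
    by (simp add: c_def matrix_unit_mult_matrix_unit_eq_0 \<psi>_idempotent plus_incidence.rep_eq
        inc_app_matrix_unit_mult inc_app_mult_matrix_unit zero zero_incidence.rep_eq)
  \<comment> \<open>column \<open>v\<close> of \<open>a\<close> is column \<open>v\<close> of \<open>d(e\<^sub>v)\<close>\<close>
  define a where "a = Abs_incidence (\<lambda>u v. c v u v)"
  have a: "inc_app a u v = c v u v" for u v
    unfolding a_def by (subst Abs_incidence_inverse) (auto simp: c_def inc_app_eq_0)
  have "d (matrix_unit v v) = a * matrix_unit v v - \<psi> (matrix_unit v v) * a" for v
  proof (rule incidence_eqI)
    fix u w
    have "c v u w = (if w = v then c v u v else 0) - (if u = l v then c w (l v) w else 0)"
    proof (cases "v = w")
      case True
      then show ?thesis using diag0 by auto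
    next
      case False
      then show ?thesis using diag[of v u w] off[OF False] by (auto simp: eq_neg_iff_add_eq_0)
    qed
    then show "inc_app (d (matrix_unit v v)) u w =
        inc_app (a * matrix_unit v v - \<psi> (matrix_unit v v) * a) u w"
      by (simp add: inc_app_inner_matrix_unit a \<sigma>_refl flip: c_def)
  qed
  then show ?thesis by blast
qed

text \<open>
  If \<open>d\<close> kills the idempotents, the Leibniz rule lets them pass through \<open>d\<close>, up to the twist on
  the left: \<open>e\<^bsub>l x\<^esub> d(b) e\<^sub>y = d(e\<^sub>x b e\<^sub>y)\<close>. Hence the entry of \<open>d(b)\<close> at \<open>(l x, y)\<close> depends only on
  \<open>b(x, y)\<close>. The cocycle identity for the resulting coefficients is the Leibniz rule for
  \<open>e\<^bsub>xy\<^esub> e\<^bsub>yz\<^esub> = e\<^bsub>xz\<^esub>\<close>.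
\<close>

lemma cochain_derivation_if_zero_on_idempotents:
  assumes d: "d \<in> twisted_derivations inc_scale \<psi>"
    and idem: "\<And>v. d (matrix_unit v v) = 0"
  shows "\<exists>f\<in>cocycles \<sigma> l 1. d = cochain_derivation f"
proof -
  interpret Vector_Spaces.linear inc_scale inc_scale d
    using d by (simp add: twisted_derivations_def)
  have leibniz: "d (p * q) = d p * q + \<psi> p * d q" for p q
    using d by (simp add: twisted_derivations_def)
  define g where "g x y = inc_app (d (matrix_unit x y)) (l x) y" for x y
  have entry: "inc_app (d b) (l x) y = g x y * inc_app b x y" for b x y
  proof -
    have "matrix_unit (l x) (l x) * d b * matrix_unit y y =
        d (matrix_unit x x * b * matrix_unit y y)"
      by (simp add: leibniz idem \<psi>_idempotent)
    also have "\<dots> = inc_scale (inc_app b x y) (d (matrix_unit x y))"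
      by (simp add: matrix_unit_corner scale)
    finally have "inc_app (matrix_unit (l x) (l x) * d b * matrix_unit y y) (l x) y =
        inc_app (inc_scale (inc_app b x y) (d (matrix_unit x y))) (l x) y" by simp
    then show ?thesis
      by (simp add: inc_app_matrix_unit_mult inc_app_mult_matrix_unit inc_scale.rep_eq g_def)
  qed
  define f where "f xs = (if xs \<in> chains 2 then g (xs ! 0) (xs ! 1) else 0)" for xs
  have fg: "f [x, y] = g x y" if "x \<le> y" for x y
    using that by (simp add: f_def chains_2)
  have "f \<in> cocycles \<sigma> l 1"
    unfolding cocycles_1_iff
  proof (intro conjI allI impI)
    fix xs assume "f xs \<noteq> 0"
    then obtain x y where xs: "xs = [x, y]" "x \<le> y" and "g x y \<noteq> 0"
      by (auto simp: f_def chains_2 split: if_splits)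
    then have "l x \<le> y" using inc_app_eq_0 by (auto simp: g_def)
    with xs show "\<exists>x y. xs = [x, y] \<and> x \<le> y \<and> l x \<le> y" by blast
  next
    fix x y z :: 'x assume le: "x \<le> y" "y \<le> z"
    have "d (matrix_unit x z) = d (matrix_unit x y) * matrix_unit y z
        + \<psi> (matrix_unit x y) * d (matrix_unit y z)"
      using le by (simp add: matrix_unit_mult_matrix_unit flip: leibniz)
    from arg_cong[OF this, of "\<lambda>f. inc_app f (l x) z"]
    have "g x z = g x y + inc_app \<sigma> (l x) (l y) * g y z"
      using le by (simp add: g_def plus_incidence.rep_eq inc_app_mult_matrix_unit \<psi>_matrix_unit
          inc_scale_mult inc_scale.rep_eq inc_app_matrix_unit_mult)
    then show "f [x, z] = f [x, y] + inc_app \<sigma> (l x) (l y) * f [y, z]"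
      using le by (simp add: fg order_trans[OF le])
  qed
  moreover from this have "d b = cochain_derivation f b" for b
    by (intro incidence_eqI')
       (metis entry inc_app_cochain_derivation fg inc_app_eq_0 mult_zero_right)
  ultimately show ?thesis by blast
qed

lemma twisted_derivation_decomposition:
  assumes d: "d \<in> twisted_derivations inc_scale \<psi>"
  shows "\<exists>f\<in>cocycles \<sigma> l 1. d - cochain_derivation f \<in> inner_twisted_derivations \<psi>"
proof -
  interpret vector_space "inc_scale :: 'k \<Rightarrow> ('x, 'k) incidence \<Rightarrow> _"
    by (rule vector_space_inc_scale)
  obtain a where a: "\<And>v. d (matrix_unit v v) = a * matrix_unit v v - \<psi> (matrix_unit v v) * a"
    using agrees_with_inner_on_idempotents[OF d] by blast
  let ?D = "\<lambda>b. a * b - \<psi> b * a"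
  have "Vector_Spaces.linear inc_scale inc_scale d" "Vector_Spaces.linear inc_scale inc_scale ?D"
    using d inner_in_twisted_derivations[of a] by (simp_all add: twisted_derivations_def)
  then have "Vector_Spaces.linear inc_scale inc_scale (d - ?D)"
    by (simp add: Vector_Spaces.linear_iff fun_diff_def scale_right_diff_distrib)
  then have "d - ?D \<in> twisted_derivations inc_scale \<psi>"
    using d inner_in_twisted_derivations[of a] by (simp add: twisted_derivations_def algebra_simps)
  then obtain f where f: "f \<in> cocycles \<sigma> l 1" "d - ?D = cochain_derivation f"
    using cochain_derivation_if_zero_on_idempotents[of "d - ?D"] a by auto
  then have "d - cochain_derivation f = ?D" by (simp flip: f(2))
  with f(1) show ?thesis
    by (intro bexI[of _ f]) (auto simp: inner_twisted_derivations_def)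
qed

text \<open>
  The equation \<open>\<delta>\<^sup>2 = 0\<close> rests on \<open>\<sigma>(l x, l z) = \<sigma>(l x, l y) \<sigma>(l y, l z)\<close>, and the support condition
  on \<open>l x \<le> l y\<close>: if \<open>l x \<le> x\<close> or \<open>l y \<le> y\<close>, then \<open>l x \<le> y\<close>.
\<close>

lemma coboundaries_subset_cocycles: "coboundaries \<sigma> l 1 \<subseteq> cocycles \<sigma> l 1"
proof
  fix f assume "f \<in> coboundaries \<sigma> l 1"
  then obtain g where f0: "\<And>xs. xs \<notin> chains 2 \<Longrightarrow> f xs = 0"
    and g: "\<And>x. g x \<noteq> 0 \<Longrightarrow> l x \<le> x"
    and f: "\<And>x y. x \<le> y \<Longrightarrow> f [x, y] = inc_app \<sigma> (l x) (l y) * g y - g x"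
    by (rule coboundaries_1E) (rule that)
  show "f \<in> cocycles \<sigma> l 1"
    unfolding cocycles_1_iff
  proof (intro conjI allI impI)
    fix xs assume "f xs \<noteq> 0"
    then obtain x y where xs: "xs = [x, y]" "x \<le> y" and "f [x, y] \<noteq> 0"
      using f0[of xs] by (auto simp: chains_2)
    then have "g y \<noteq> 0 \<or> g x \<noteq> 0" using f by auto
    then have "l x \<le> y"
      using g[of x] g[of y] xs(2) l_le_iff[of x y] order_trans by blast
    with xs show "\<exists>x y. xs = [x, y] \<and> x \<le> y \<and> l x \<le> y" by blast
  next
    fix x y z :: 'x assume le: "x \<le> y" "y \<le> z"
    then show "f [x, z] = f [x, y] + inc_app \<sigma> (l x) (l y) * f [y, z]"
      using \<sigma>_trans[of "l x" "l y" "l z"] order_trans[OF le] by (simp add: f algebra_simps)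
  qed
qed

text \<open>
  On the matrix unit \<open>e\<^bsub>xy\<^esub>\<close>, the inner derivation of \<open>a\<close> has the entry
  \<open>a(l x, x) - \<sigma>(l x, l y) a(l y, y)\<close> at \<open>(l x, y)\<close>, which is the coboundary of
  \<open>x \<mapsto> - a(l x, x)\<close>. Conversely, a \<open>0\<close>-cochain can be placed with the opposite sign on these
  positions, since it is supported where \<open>l x \<le> x\<close>.
\<close>

lemma cochain_derivation_inner_iff:
  assumes f: "f \<in> cocycles \<sigma> l 1"
  shows "cochain_derivation f \<in> inner_twisted_derivations \<psi> \<longleftrightarrow> f \<in> coboundaries \<sigma> l 1"
proof
  note app = inc_app_cochain_derivation[OF f]
  {
    assume "cochain_derivation f \<in> inner_twisted_derivations \<psi>"
    then obtain a where a: "\<And>b. cochain_derivation f b = a * b - \<psi> b * a"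
      by (auto simp: inner_twisted_derivations_def)
    have "f [x, y] = inc_app a (l x) x - inc_app \<sigma> (l x) (l y) * inc_app a (l y) y" if "x \<le> y" for x y
      using app[of "matrix_unit x y" x y] that
      by (simp add: a inc_app_inner_matrix_unit) (simp add: matrix_unit.rep_eq)
    moreover have "f xs = 0" if "xs \<notin> chains 2" for xs
      using cocycles_1_support[OF f, of xs] that by (auto simp: chains_2)
    ultimately show "f \<in> coboundaries \<sigma> l 1"
      by (intro coboundaries_1I[where g = "\<lambda>x. - inc_app a (l x) x"])
         (simp_all, metis inc_app_eq_0)
  next
    assume "f \<in> coboundaries \<sigma> l 1"
    then obtain g where g: "\<And>x. g x \<noteq> 0 \<Longrightarrow> l x \<le> x"
      and fg: "\<And>x y. x \<le> y \<Longrightarrow> f [x, y] = inc_app \<sigma> (l x) (l y) * g y - g x"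
      by (rule coboundaries_1E) (rule that)
    define a where "a = Abs_incidence (\<lambda>u v. if u = l v then - g v else 0)"
    have a: "inc_app a u v = (if u = l v then - g v else 0)" for u v
      unfolding a_def by (subst Abs_incidence_inverse) (use g in auto)
    have "cochain_derivation f b = a * b - \<psi> b * a" for b
    proof (rule incidence_eqI')
      fix x y
      have "inc_app (a * b) (l x) y = (\<Sum>z\<in>{l x..y}. if z = x then - g x * inc_app b x y else 0)"
        unfolding times_incidence.rep_eq a by (intro sum.cong) auto
      then have ab: "inc_app (a * b) (l x) y = - g x * inc_app b x y"
        using g[of x] by (auto simp: finite_interval inc_app_eq_0)
      have "inc_app (\<psi> b * a) (l x) y =
          (\<Sum>z\<in>{x..inv l y}. if z = y then - (inc_app \<sigma> (l x) (l y) * inc_app b x y * g y) else 0)"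
        unfolding inc_app_\<psi>_mult a by (intro sum.cong) auto
      moreover have "y \<le> inv l y" if "g y \<noteq> 0"
        using g[OF that] l_le_iff[of y "inv l y"] by simp
      ultimately have "inc_app (\<psi> b * a) (l x) y = - (inc_app \<sigma> (l x) (l y) * inc_app b x y * g y)"
        by (auto simp: finite_interval inc_app_eq_0)
      with ab show "inc_app (cochain_derivation f b) (l x) y = inc_app (a * b - \<psi> b * a) (l x) y"
        by (cases "x \<le> y") (simp_all add: app fg minus_incidence.rep_eq inc_app_eq_0 algebra_simps)
    qed
    then show "cochain_derivation f \<in> inner_twisted_derivations \<psi>"
      by (auto simp: inner_twisted_derivations_def fun_eq_iff)
  }
qed

end

section \<open>Outer twisted derivations\<close>

theorem corollary3p8:
  fixes \<beta> \<sigma> :: "('x::locally_finite_order, 'k::field) incidence"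
    and l :: "'x \<Rightarrow> 'x"
    and \<phi> :: "('x, 'k) incidence \<Rightarrow> ('x, 'k) incidence"
  assumes "ring_invertible \<beta>" and "inc_multiplicative \<sigma>" and "order_automorphism l"
    and "\<phi> = inner_automorphism \<beta> \<circ> mult_automorphism \<sigma> \<circ> induced_automorphism l"
  shows "isomorphic_spaces
           (quotient_space (fun_scale inc_scale)
              (twisted_derivations inc_scale \<phi>) (inner_twisted_derivations \<phi>))
           (cohomology \<sigma> l 1)"
proof -
  interpret monomial_twist \<sigma> l
    by standard (rule assms)+
  have \<phi>: "\<phi> = inner_automorphism \<beta> \<circ> \<psi>"
    unfolding assms(4) \<psi>_def by (simp add: comp_assoc)
  let ?\<beta> = "\<lambda>d (b :: ('x, 'k) incidence). \<beta> * d b"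
  have Der: "twisted_derivations inc_scale \<phi> = ?\<beta> ` twisted_derivations inc_scale \<psi>"
    unfolding \<phi> by (rule twisted_derivations_inner_automorphism)
      (simp_all add: assms(1) vector_space_inc_scale inc_scale_mult)
  have IDer: "inner_twisted_derivations \<phi> = ?\<beta> ` inner_twisted_derivations \<psi>"
    unfolding \<phi> by (rule inner_twisted_derivations_inner_automorphism) (rule assms(1))
  have inj: "inj ?\<beta>"
  proof (rule injI, rule ext)
    fix d e :: "('x, 'k) incidence \<Rightarrow> ('x, 'k) incidence" and b
    assume "?\<beta> d = ?\<beta> e"
    then have "ring_inverse \<beta> * (\<beta> * d b) = ring_inverse \<beta> * (\<beta> * e b)" by metis
    then show "d b = e b" using ring_inverse(2)[OF assms(1)] by (simp flip: mult.assoc)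
  qed
  show ?thesis
    unfolding cohomology_def
  proof (rule isomorphic_quotient_spacesI)
    show "Vector_Spaces.linear (fun_scale (*)) (fun_scale inc_scale)
        (\<lambda>f. ?\<beta> (cochain_derivation f))"
      unfolding Vector_Spaces.linear_iff
      by (simp add: vector_space_fun_scale vector_space_inc_scale linear_cochain_derivation
          vector_space_field fun_eq_iff distrib_left inc_scale_mult)
         (simp add: fun_scale_def)
    show "module.subspace (fun_scale inc_scale) (inner_twisted_derivations \<phi>)"
      by (rule subspace_inner_twisted_derivations) (simp_all add: vector_space_inc_scale inc_scale_mult)
    show "module.subspace (fun_scale (*)) (cocycles \<sigma> l 1)"
      by (rule subspace_cocycles_1)
    show "(\<lambda>f. ?\<beta> (cochain_derivation f)) ` cocycles \<sigma> l 1 \<subseteq> twisted_derivations inc_scale \<phi>"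
      unfolding Der using cochain_derivation_in_twisted_derivations by blast
    show "\<exists>f\<in>cocycles \<sigma> l 1. d - ?\<beta> (cochain_derivation f) \<in> inner_twisted_derivations \<phi>"
      if d: "d \<in> twisted_derivations inc_scale \<phi>" for d
    proof -
      obtain e where e: "e \<in> twisted_derivations inc_scale \<psi>" "d = ?\<beta> e"
        using d unfolding Der by blast
      then obtain f where f: "f \<in> cocycles \<sigma> l 1"
        "e - cochain_derivation f \<in> inner_twisted_derivations \<psi>"
        using twisted_derivation_decomposition by blast
      have "d - ?\<beta> (cochain_derivation f) = ?\<beta> (e - cochain_derivation f)"
        by (simp add: e fun_eq_iff right_diff_distrib)
      with f show ?thesis unfolding IDer by blast
    qed
    show "cocycles \<sigma> l 1 \<inter> (\<lambda>f. ?\<beta> (cochain_derivation f)) -` inner_twisted_derivations \<phi> =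
        coboundaries \<sigma> l 1"
    proof -
      have "?\<beta> e \<in> inner_twisted_derivations \<phi> \<longleftrightarrow> e \<in> inner_twisted_derivations \<psi>" for e
        unfolding IDer by (rule inj_image_mem_iff[OF inj])
      then show ?thesis
        using cochain_derivation_inner_iff coboundaries_subset_cocycles by blast
    qed
  qed
qed

end
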